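(* Let $\Phi$ be a root system of type $C_\ell$ ($\ell\ge3$) and $\omega=\omega_\ell$. Then the set $\Phi_{\omega,0}^+=\{\beta\in\Phi^+:\beta^\omega=0\}$ is $$\Phi_{\omega,0}^+=\{e_{p_1}+e_{\ell-p_1+1}: p_1\in\{1,\dots,\lfloor\tfrac{\ell+1}2\rfloor\}\}$$ $$=\{\alpha_{i_1}+\cdots+\alpha_{\ell-i_1}+2\alpha_{\ell-i_1+1}+\cdots+2\alpha_{\ell-1}+\alpha_\ell : i_1\in\{1,\dots,\lfloor\tfrac{\ell+1}2\rfloor\}\}.$$ Hence $P(0)=\{\pm1\}$.
   Context: Realize $\Phi$ of type $C_\ell$ in $E=\mathbb{R}^\ell$ with standard basis $e_1,\dots,e_\ell$ as $\{\pm 2e_p\}\cup\{\pm e_p\pm e_q:p<q\}$, with basis $\Delta$: $\alpha_i=e_i-e_{i+1}$ ($1\le i\le\ell-1$), $\alpha_\ell=2e_\ell$; $\Phi^+$ is the corresponding set of positive roots. Empty ranges in sums of simple roots contribute $0$. Let $\tilde\alpha=\sum_{i=1}^\ell n_i\alpha_i$ be the highest root, $\alpha_0=-\tilde\alpha$, $n_0=1$; then $J=\{i\in\{0,\dots,\ell\}:n_i=1\}=\{0,\ell\}$. Let $w_0$ be the longest element of the Weyl group $W$, $w_\ell$ the longest element of the subgroup generated by $s_{\alpha_1},\dots,s_{\alpha_{\ell-1}}$, and $\omega=\omega_\ell=w_\ell w_0$; it acts on $\{\alpha_0,\dots,\alpha_\ell\}$ by the index permutation $\sigma: i\mapsto\ell-i$.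 Put $x^\omega=\frac1{o(\omega)}\sum_{t=1}^{o(\omega)}\omega^t(x)$ with $o(\omega)=2$ the order of $\omega$. Let $\varpi_1^\vee,\dots,\varpi_\ell^\vee$ be the dual basis of $\Delta$, $\varpi_0^\vee=0$, and $\pi_0^\ell=\varpi_0^\vee+\varpi_\ell^\vee$ the sum over the $\langle\sigma\rangle$-orbit of $0$. Put $P(0)=\{(\gamma,\pi_0^\ell):\gamma\in\Phi,\ \gamma^\omega=0\}$. *)

theory Defs
  imports
    "HOL-Analysis.Analysis"
    "HOL-Algebra.Bij"
    "HOL-Algebra.Generated_Groups"
    "HOL-Algebra.Multiplicative_Group"
    "HOL-Combinatorics.Orbits"
begin

text \<open>Throughout, \<open>e 1, \<dots>, e l\<close> is the standard basis of the ambient space; values of \<open>e\<close>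
  outside \<open>{1..l}\<close> are irrelevant.\<close>

definition type_C_roots :: "(nat \<Rightarrow> 'a::euclidean_space) \<Rightarrow> nat \<Rightarrow> 'a set" where
  "type_C_roots e l =
     {s *\<^sub>R (2 *\<^sub>R e p) | s p. s \<in> {1, -1} \<and> p \<in> {1..l}} \<union>
     {s *\<^sub>R e p + t *\<^sub>R e q | s t p q.
        s \<in> {1, -1} \<and> t \<in> {1, -1} \<and> p \<in> {1..l} \<and> q \<in> {1..l} \<and> p < q}"

definition simple_root :: "(nat \<Rightarrow> 'a::euclidean_space) \<Rightarrow> nat \<Rightarrow> nat \<Rightarrow> 'a" where
  "simple_root e l i = (if i < l then e i - e (i + 1) else 2 *\<^sub>R e l)"

definition positive_roots :: "(nat \<Rightarrow> 'a::euclidean_space) \<Rightarrow> nat \<Rightarrow> 'a set" where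
  "positive_roots e l =
     {\<beta> \<in> type_C_roots e l. \<exists>c :: nat \<Rightarrow> nat. \<beta> = (\<Sum>i = 1..l. real (c i) *\<^sub>R simple_root e l i)}"

definition reflection :: "'a::euclidean_space \<Rightarrow> 'a \<Rightarrow> 'a" where
  "reflection \<beta> x = x - (2 * (x \<bullet> \<beta>) / (\<beta> \<bullet> \<beta>)) *\<^sub>R \<beta>"

text \<open>Subgroup generated by a set of permutations of the ambient space.\<close>

definition generated_group :: "('a \<Rightarrow> 'a) set \<Rightarrow> ('a \<Rightarrow> 'a) set" where
  "generated_group S = generate (BijGroup UNIV) S"

text \<open>Only meaningful for \<open>w\<close> in the submonoid generated by \<open>S\<close>; for a set \<open>S\<close> of involutions
  this is the whole group generated by \<open>S\<close>.\<close>

definition word_length :: "('a \<Rightarrow> 'a) set \<Rightarrow> ('a \<Rightarrow> 'a) \<Rightarrow> nat" where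
  "word_length S w = (LEAST n. \<exists>ss. length ss = n \<and> set ss \<subseteq> S \<and> w = foldr (\<circ>) ss id)"

definition longest_element :: "('a \<Rightarrow> 'a) set \<Rightarrow> ('a \<Rightarrow> 'a) set \<Rightarrow> 'a \<Rightarrow> 'a" where
  "longest_element W S = (THE w. w \<in> W \<and> (\<forall>v \<in> W. word_length S v \<le> word_length S w))"

definition weyl_group :: "(nat \<Rightarrow> 'a::euclidean_space) \<Rightarrow> nat \<Rightarrow> ('a \<Rightarrow> 'a) set" where
  "weyl_group e l = generated_group (reflection ` type_C_roots e l)"

definition simple_reflections :: "(nat \<Rightarrow> 'a::euclidean_space) \<Rightarrow> nat \<Rightarrow> nat set \<Rightarrow> ('a \<Rightarrow> 'a) set" where
  "simple_reflections e l I = (\<lambda>i. reflection (simple_root e l i)) ` I"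

definition w_zero :: "(nat \<Rightarrow> 'a::euclidean_space) \<Rightarrow> nat \<Rightarrow> 'a \<Rightarrow> 'a" where
  "w_zero e l = longest_element (weyl_group e l) (simple_reflections e l {1..l})"

definition w_ell :: "(nat \<Rightarrow> 'a::euclidean_space) \<Rightarrow> nat \<Rightarrow> 'a \<Rightarrow> 'a" where
  "w_ell e l =
     longest_element (generated_group (simple_reflections e l {1..l - 1}))
       (simple_reflections e l {1..l - 1})"

definition omega :: "(nat \<Rightarrow> 'a::euclidean_space) \<Rightarrow> nat \<Rightarrow> 'a \<Rightarrow> 'a" where
  "omega e l = w_ell e l \<circ> w_zero e l"

definition average :: "('a::euclidean_space \<Rightarrow> 'a) \<Rightarrow> 'a \<Rightarrow> 'a" where
  "average w x =
     (1 / real (group.ord (BijGroup UNIV) w)) *\<^sub>R (\<Sum>t = 1..group.ord (BijGroup UNIV) w. (w ^^ t) x)"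

definition positive_roots_omega_0 :: "(nat \<Rightarrow> 'a::euclidean_space) \<Rightarrow> nat \<Rightarrow> 'a set" where
  "positive_roots_omega_0 e l = {\<beta> \<in> positive_roots e l. average (omega e l) \<beta> = 0}"

definition fund_coweight :: "(nat \<Rightarrow> 'a::euclidean_space) \<Rightarrow> nat \<Rightarrow> nat \<Rightarrow> 'a" where
  "fund_coweight e l j =
     (if j = 0 then 0
      else (THE v. \<forall>i \<in> {1..l}. simple_root e l i \<bullet> v = (if i = j then 1 else 0)))"

text \<open>The permutation of \<open>{0..l}\<close> by which \<open>\<omega>\<close> permutes \<open>\<alpha>\<^sub>0, \<dots>, \<alpha>\<^sub>l\<close>, where \<open>-\<alpha>\<^sub>0\<close> is the
  highest root.\<close>

definition sigma :: "nat \<Rightarrow> nat \<Rightarrow> nat" where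
  "sigma l i = l - i"

definition pi_zero :: "(nat \<Rightarrow> 'a::euclidean_space) \<Rightarrow> nat \<Rightarrow> 'a" where
  "pi_zero e l = (\<Sum>j \<in> orbit (sigma l) 0. fund_coweight e l j)"

definition P_zero :: "(nat \<Rightarrow> 'a::euclidean_space) \<Rightarrow> nat \<Rightarrow> real set" where
  "P_zero e l =
     {\<gamma> \<bullet> pi_zero e l | \<gamma>. \<gamma> \<in> type_C_roots e l \<and> average (omega e l) \<gamma> = 0}"

end

theory Submission
  imports Defs
begin

text \<open>
  The Weyl group of type \<open>C\<^sub>l\<close> consists of the signed permutations of the basis vectors, and the
  subgroup generated by the first \<open>l - 1\<close> simple reflections consists of the permutations.  Their
  longest elements are \<open>-1\<close> and the order-reversing permutation \<open>e p \<mapsto> e (l + 1 - p)\<close>, so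
  \<open>\<omega>\<close> is the involution \<open>e p \<mapsto> - e (l + 1 - p)\<close>.  Averaging over an involution kills exactly
  the vectors negated by it: \<open>\<beta>\<^sup>\<omega> = 0\<close> says that \<open>\<beta>\<close> is fixed by the reversal.  The roots
  fixed by the reversal are \<open>\<plusminus>(e p + e (l + 1 - p))\<close>; the sign is read off from
  positivity, and exchanging the two summands allows one to take \<open>p \<le> (l + 1) / 2\<close>.  Finally
  \<open>\<pi>\<^sub>0\<close> is the last fundamental coweight, half the sum of the basis vectors, and pairs
  with these roots to \<open>\<plusminus>1\<close>.

  Most of the work is to identify the longest elements, since they are specified through word
  length.  The locale \<open>reflection_group\<close> treats both groups at once.  It takes
  positivity of a root to mean positive inner product with a vector \<open>\<rho>\<close>, and shows that the
  length of \<open>w\<close> is the number of positive roots that \<open>w\<close> makes negative.  Two facts carry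
  this: multiplication by a simple reflection raises that number by at most one, and every
  element other than the identity makes some simple root negative.  It follows
  that an element of the group which makes all positive roots negative is the only longest one
  (\<open>longest_element_eq\<close>), and that the group is generated by the simple reflections.

  For both types the vector \<open>\<rho> = \<Sum>p. (l + 1 - p) e p\<close> works, half the sum of the positive
  roots of \<open>C\<^sub>l\<close>.  A signed permutation that keeps all simple roots positive maps
  \<open>e 1, \<dots>, e l\<close> to vectors of strictly decreasing positive integral height at most \<open>l\<close>,
  hence fixes all of them (\<open>signed_permutation_eq_id\<close>).
\<close>

section \<open>Reflections and the groups they generate\<close>

lemma linear_reflection: "linear (reflection \<alpha>)"
  by (rule linearI)
    (auto simp: reflection_def inner_add_left algebra_simps add_divide_distrib)

lemma reflection_self: "\<alpha> \<noteq> 0 \<Longrightarrow> reflection \<alpha> \<alpha> = - \<alpha>"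
  by (simp add: reflection_def algebra_simps scaleR_2)

lemma reflection_reflection:
  assumes "\<alpha> \<noteq> 0"
  shows "reflection \<alpha> (reflection \<alpha> x) = x"
proof -
  have "reflection \<alpha> (reflection \<alpha> x)
    = reflection \<alpha> x - (2 * (x \<bullet> \<alpha>) / (\<alpha> \<bullet> \<alpha>)) *\<^sub>R reflection \<alpha> \<alpha>"
    by (subst (2) reflection_def)
      (simp add: linear_diff[OF linear_reflection] linear_scale[OF linear_reflection])
  then show ?thesis
    using assms by (simp add: reflection_self) (simp add: reflection_def)
qed

lemma reflection_comp_reflection: "\<alpha> \<noteq> 0 \<Longrightarrow> reflection \<alpha> \<circ> reflection \<alpha> = id"
  by (auto simp: fun_eq_iff reflection_reflection)

lemma inj_reflection: "\<alpha> \<noteq> 0 \<Longrightarrow> inj (reflection \<alpha>)"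
  by (metis injI reflection_reflection)

lemma bij_comp_self_id: "f \<circ> f = id \<Longrightarrow> bij f"
  using o_bij by blast

lemma mem_carrier_BijGroup_UNIV: "f \<in> carrier (BijGroup UNIV) \<longleftrightarrow> bij f"
  by (simp add: BijGroup_def Bij_def)

lemma mult_BijGroup_UNIV:
  "bij f \<Longrightarrow> bij g \<Longrightarrow> f \<otimes>\<^bsub>BijGroup UNIV\<^esub> g = f \<circ> g"
  by (simp add: BijGroup_def Bij_def compose_def fun_eq_iff)

lemma one_BijGroup_UNIV: "\<one>\<^bsub>BijGroup UNIV\<^esub> = id"
  by (simp add: BijGroup_def fun_eq_iff)

text \<open>A generated subgroup is closed under inverses of generators; when these are involutions, the
  inverses are generators again.\<close>

lemma m_inv_BijGroup_UNIV:
  assumes "f \<circ> f = id"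
  shows "inv\<^bsub>BijGroup UNIV\<^esub> f = f"
  using assms bij_comp_self_id[OF assms]
  by (intro group.inv_equality[OF group_BijGroup])
    (auto simp: mult_BijGroup_UNIV one_BijGroup_UNIV mem_carrier_BijGroup_UNIV)

lemma ord_BijGroup_involution:
  assumes "f \<circ> f = id" "f \<noteq> id"
  shows "group.ord (BijGroup UNIV) f = 2"
proof -
  interpret group "BijGroup (UNIV :: 'a set)" by (rule group_BijGroup)
  have f: "f \<in> carrier (BijGroup UNIV)"
    using bij_comp_self_id[OF assms(1)] by (simp add: mem_carrier_BijGroup_UNIV)
  have "f [^]\<^bsub>BijGroup UNIV\<^esub> (2::nat) = \<one>\<^bsub>BijGroup UNIV\<^esub>"
    using f assms(1)
    by (simp add: numeral_2_eq_2 mult_BijGroup_UNIV mem_carrier_BijGroup_UNIV one_BijGroup_UNIV)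
  then have "ord f dvd 2" using f pow_eq_id by blast
  moreover have "ord f \<noteq> 1" using f assms(2) ord_eq_1 one_BijGroup_UNIV by metis
  ultimately show ?thesis using prime_nat_iff two_is_prime_nat by blast
qed

lemma generated_group_subset:
  assumes "id \<in> W" "T \<subseteq> W" "\<And>v w. v \<in> W \<Longrightarrow> w \<in> W \<Longrightarrow> v \<circ> w \<in> W"
    and bij: "\<And>w. w \<in> W \<Longrightarrow> bij w"
    and invol: "\<And>s. s \<in> T \<Longrightarrow> s \<circ> s = id"
  shows "generated_group T \<subseteq> W"
proof
  fix w assume "w \<in> generated_group T"
  then have "w \<in> generate (BijGroup UNIV) T" by (simp add: generated_group_def)
  then show "w \<in> W"
  proof induction
    case one show ?case unfolding one_BijGroup_UNIV by (rule assms(1))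
  next
    case (incl h) then show ?case using assms(2) by blast
  next
    case (inv h) then show ?case using assms(2) invol by (auto simp: m_inv_BijGroup_UNIV)
  next
    case (eng h1 h2) then show ?case using assms(3) bij by (metis mult_BijGroup_UNIV)
  qed
qed

lemma foldr_in_generated_group:
  assumes "\<And>s. s \<in> T \<Longrightarrow> bij s"
  shows "set ss \<subseteq> T \<Longrightarrow> foldr (\<circ>) ss id \<in> generated_group T \<and> bij (foldr (\<circ>) ss id)"
proof (induction ss)
  case Nil
  show ?case
    using generate.one[of "BijGroup UNIV" T] bij_id[where 'a = 'a]
    by (simp add: generated_group_def one_BijGroup_UNIV id_def)
next
  case (Cons s ss)
  then have "set ss \<subseteq> T" and s: "s \<in> generated_group T" "bij s"
    by (auto simp: generated_group_def assms intro: generate.incl)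
  have IH: "foldr (\<circ>) ss id \<in> generated_group T" "bij (foldr (\<circ>) ss id)"
    using Cons.IH \<open>set ss \<subseteq> T\<close> by blast+
  have "foldr (\<circ>) (s # ss) id = s \<circ> foldr (\<circ>) ss id"
    by (rule trans[OF fun_cong[OF foldr_Cons]], rule comp_apply)
  moreover have "s \<circ> foldr (\<circ>) ss id \<in> generated_group T"
    using generate.eng[of s "BijGroup UNIV" T "foldr (\<circ>) ss id"] s IH
    unfolding generated_group_def mult_BijGroup_UNIV[OF s(2) IH(2)] by blast
  ultimately show ?case using bij_comp[OF IH(2) s(2)] by metis
qed

lemma foldr_comp_snoc: "foldr (\<circ>) (ss @ [s]) id = foldr (\<circ>) ss id \<circ> s"
  by (induction ss) (auto simp: comp_assoc)

section \<open>Length and inversions\<close>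

text \<open>\<open>R\<close> is a root system, \<open>D\<close> its simple roots, \<open>\<rho>\<close> a vector that decides the sign of every
  root, and \<open>W\<close> a concretely known group of linear symmetries of \<open>R\<close>.  That \<open>W\<close> is generated
  by the simple reflections is a conclusion, not an assumption.  The two assumptions with content
  are \<open>reflection_pos\<close>, by which a simple reflection changes the sign of no other positive root,
  and \<open>ex_descent\<close>, which replaces the usual argument through nonnegative combinations of simple
  roots.\<close>

locale reflection_group =
  fixes R D :: "'a::euclidean_space set" and \<rho> :: 'a and W :: "('a \<Rightarrow> 'a) set"
  assumes finite_R: "finite R"
    and uminus_R: "\<beta> \<in> R \<Longrightarrow> - \<beta> \<in> R"
    and regular: "\<beta> \<in> R \<Longrightarrow> \<beta> \<bullet> \<rho> \<noteq> 0"
    and D_subset: "D \<subseteq> R"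
    and D_pos: "\<alpha> \<in> D \<Longrightarrow> \<alpha> \<bullet> \<rho> > 0"
    and reflection_pos:
      "\<alpha> \<in> D \<Longrightarrow> \<beta> \<in> R \<Longrightarrow> \<beta> \<bullet> \<rho> > 0 \<Longrightarrow> \<beta> \<noteq> \<alpha> \<Longrightarrow> reflection \<alpha> \<beta> \<bullet> \<rho> > 0"
    and id_W: "id \<in> W"
    and comp_W: "v \<in> W \<Longrightarrow> w \<in> W \<Longrightarrow> v \<circ> w \<in> W"
    and reflection_W: "\<alpha> \<in> D \<Longrightarrow> reflection \<alpha> \<in> W"
    and linear_W: "w \<in> W \<Longrightarrow> linear w"
    and inj_W: "w \<in> W \<Longrightarrow> inj w"
    and W_R: "w \<in> W \<Longrightarrow> \<beta> \<in> R \<Longrightarrow> w \<beta> \<in> R"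
    and ex_descent: "w \<in> W \<Longrightarrow> w \<noteq> id \<Longrightarrow> \<exists>\<alpha>\<in>D. w \<alpha> \<bullet> \<rho> < 0"
begin

definition inversions :: "('a \<Rightarrow> 'a) \<Rightarrow> 'a set" where
  "inversions w = {\<beta> \<in> R. \<beta> \<bullet> \<rho> > 0 \<and> w \<beta> \<bullet> \<rho> < 0}"

lemma finite_inversions: "finite (inversions w)"
  using finite_R by (simp add: inversions_def)

lemma D_nonzero: "\<alpha> \<in> D \<Longrightarrow> \<alpha> \<noteq> 0"
  using D_pos by fastforce

lemma foldr_W: "set ss \<subseteq> reflection ` D \<Longrightarrow> foldr (\<circ>) ss id \<in> W"
  by (induction ss) (auto simp: id_W comp_W reflection_W)

text \<open>A new inversion \<open>\<beta>\<close> can only arise when \<open>w \<beta>\<close> is the single positive root \<open>\<alpha>\<close> that the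
  reflection makes negative.  This bounds the length from below.\<close>

lemma card_inversions_reflection_comp:
  assumes "\<alpha> \<in> D" "w \<in> W"
  shows "card (inversions (reflection \<alpha> \<circ> w)) \<le> Suc (card (inversions w))"
proof -
  have "inversions (reflection \<alpha> \<circ> w) \<subseteq> insert (inv_into UNIV w \<alpha>) (inversions w)"
  proof
    fix \<beta> assume \<beta>: "\<beta> \<in> inversions (reflection \<alpha> \<circ> w)"
    show "\<beta> \<in> insert (inv_into UNIV w \<alpha>) (inversions w)"
    proof (cases "w \<beta> = \<alpha>")
      case True
      then show ?thesis using inj_W[OF assms(2)] by (metis inv_f_f insertI1)
    next
      case False
      then show ?thesis
        using \<beta> assms reflection_pos[of \<alpha> "w \<beta>"] W_R regular[of "w \<beta>"]
        by (fastforce simp: inversions_def)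
    qed
  qed
  then have "card (inversions (reflection \<alpha> \<circ> w)) \<le> card (insert (inv_into UNIV w \<alpha>) (inversions w))"
    by (intro card_mono) (auto simp: finite_inversions)
  also have "\<dots> \<le> Suc (card (inversions w))" by (simp add: card_insert_if finite_inversions)
  finally show ?thesis .
qed

lemma card_inversions_foldr:
  "set ss \<subseteq> reflection ` D \<Longrightarrow> card (inversions (foldr (\<circ>) ss id)) \<le> length ss"
proof (induction ss)
  case Nil
  have "inversions id = {}" by (auto simp: inversions_def)
  then show ?case unfolding foldr_Nil id_apply by (simp only: card.empty le0)
next
  case (Cons s ss)
  then obtain \<alpha> where \<alpha>: "\<alpha> \<in> D" "s = reflection \<alpha>" by auto
  have "set ss \<subseteq> reflection ` D" using Cons.prems by simp
  have IH: "card (inversions (foldr (\<circ>) ss id)) \<le> length ss" "foldr (\<circ>) ss id \<in> W"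
    using Cons.IH foldr_W[of ss] \<open>set ss \<subseteq> reflection ` D\<close> by blast+
  have "card (inversions (s \<circ> foldr (\<circ>) ss id)) \<le> Suc (length ss)"
    using card_inversions_reflection_comp[OF \<alpha>(1) IH(2)] IH(1) unfolding \<alpha>(2)[symmetric]
    by linarith
  then show ?case unfolding foldr_Cons comp_apply list.size by simp
qed

text \<open>The reflection permutes the positive roots other than \<open>\<alpha>\<close>, so it carries the inversions
  of \<open>w \<circ> reflection \<alpha>\<close> to inversions of \<open>w\<close>; but \<open>\<alpha>\<close> itself is lost.\<close>

lemma card_inversions_comp_reflection:
  assumes "\<alpha> \<in> D" "w \<in> W" and neg: "w \<alpha> \<bullet> \<rho> < 0"
  shows "card (inversions (w \<circ> reflection \<alpha>)) < card (inversions w)"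
proof -
  let ?s = "reflection \<alpha>"
  have \<alpha>: "\<alpha> \<in> R" "\<alpha> \<bullet> \<rho> > 0" "?s \<alpha> = - \<alpha>"
    using assms(1) D_subset by (auto simp: D_pos reflection_self D_nonzero)
  have w\<alpha>: "w (- \<alpha>) = - w \<alpha>" using linear_W[OF assms(2)] by (rule linear_neg)
  have "?s ` inversions (w \<circ> ?s) \<subseteq> inversions w - {\<alpha>}"
  proof
    fix \<gamma> assume "\<gamma> \<in> ?s ` inversions (w \<circ> ?s)"
    then obtain \<beta> where \<beta>: "\<beta> \<in> R" "\<beta> \<bullet> \<rho> > 0" "w (?s \<beta>) \<bullet> \<rho> < 0" "\<gamma> = ?s \<beta>"
      by (auto simp: inversions_def)
    have "\<beta> \<noteq> \<alpha>" using \<beta>(3) \<alpha>(3) w\<alpha> neg by auto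
    then have "?s \<beta> \<bullet> \<rho> > 0" using reflection_pos assms(1) \<beta> by blast
    moreover have "?s \<beta> \<noteq> \<alpha>"
    proof
      assume "?s \<beta> = \<alpha>"
      then have "\<beta> = ?s \<alpha>" using reflection_reflection[OF D_nonzero[OF assms(1)], of \<beta>] by simp
      then show False using \<alpha> \<beta>(2) by simp
    qed
    moreover have "?s \<beta> \<in> R" using W_R reflection_W assms(1) \<beta> by blast
    ultimately show "\<gamma> \<in> inversions w - {\<alpha>}" using \<beta> by (auto simp: inversions_def)
  qed
  then have "card (?s ` inversions (w \<circ> ?s)) \<le> card (inversions w - {\<alpha>})"
    by (intro card_mono) (auto simp: finite_inversions)
  moreover have "card (?s ` inversions (w \<circ> ?s)) = card (inversions (w \<circ> ?s))"
    using inj_reflection[OF D_nonzero[OF assms(1)]] by (intro card_image) (auto intro: inj_on_subset)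
  moreover have "\<alpha> \<in> inversions w" using \<alpha> neg by (simp add: inversions_def)
  then have "card (inversions w - {\<alpha>}) < card (inversions w)"
    by (rule card_Diff1_less[OF finite_inversions])
  ultimately show ?thesis by linarith
qed

text \<open>Descend: as long as the element is not the identity, multiplying by the reflection in a simple
  root that it makes negative removes an inversion.\<close>

lemma ex_word:
  "w \<in> W \<Longrightarrow> \<exists>ss. set ss \<subseteq> reflection ` D \<and> length ss \<le> card (inversions w) \<and> w = foldr (\<circ>) ss id"
proof (induction "card (inversions w)" arbitrary: w rule: less_induct)
  case less
  show ?case
  proof (cases "w = id")
    case True
    then show ?thesis by (intro exI[of _ "[]"]) auto
  next
    case False
    then obtain \<alpha> where \<alpha>: "\<alpha> \<in> D" "w \<alpha> \<bullet> \<rho> < 0" using ex_descent less.prems by blast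
    let ?v = "w \<circ> reflection \<alpha>"
    have lt: "card (inversions ?v) < card (inversions w)"
      using card_inversions_comp_reflection \<alpha> less.prems by blast
    have "?v \<in> W" using comp_W reflection_W \<alpha> less.prems by blast
    with less.hyps[OF lt] obtain ss where
      ss: "set ss \<subseteq> reflection ` D" "length ss \<le> card (inversions ?v)" "?v = foldr (\<circ>) ss id"
      by blast
    have "w = foldr (\<circ>) (ss @ [reflection \<alpha>]) id"
      unfolding foldr_comp_snoc ss(3)[symmetric]
      by (simp add: comp_assoc reflection_comp_reflection D_nonzero \<alpha>)
    then show ?thesis using ss \<alpha> lt by (intro exI[of _ "ss @ [reflection \<alpha>]"]) auto
  qed
qed

lemma word_length_eq_card_inversions:
  assumes "w \<in> W"
  shows "word_length (reflection ` D) w = card (inversions w)"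
  unfolding word_length_def
proof (rule Least_equality)
  show "\<exists>ss. length ss = card (inversions w) \<and> set ss \<subseteq> reflection ` D \<and> w = foldr (\<circ>) ss id"
    using ex_word[OF assms] card_inversions_foldr le_antisym by blast
qed (use card_inversions_foldr in blast)

text \<open>The set \<open>T\<close> is left open so that the lemma applies both to simple reflections and to all
  reflections in roots.\<close>

lemma generated_group_eq:
  assumes "reflection ` D \<subseteq> T" "T \<subseteq> W" "\<And>s. s \<in> T \<Longrightarrow> s \<circ> s = id"
  shows "generated_group T = W"
proof
  show "generated_group T \<subseteq> W"
    using assms id_W comp_W
    by (intro generated_group_subset) (auto simp: bij_def linear_W inj_W intro!: linear_inj_imp_surj)
  show "W \<subseteq> generated_group T"
  proof
    fix w assume "w \<in> W"
    then obtain ss where "set ss \<subseteq> reflection ` D" "w = foldr (\<circ>) ss id" using ex_word by blast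
    then show "w \<in> generated_group T"
      using assms bij_comp_self_id foldr_in_generated_group[of T ss] by blast
  qed
qed

text \<open>Maximality is clear, as all positive roots are inversions of \<open>w\<^sub>0\<close>.  For uniqueness, another
  element \<open>w\<close> of the same length also inverts all of them, so \<open>w \<circ> w\<^sub>0\<close> keeps all simple roots
  positive and is the identity; the same holds for \<open>w\<^sub>0 \<circ> w\<^sub>0\<close>.\<close>

lemma longest_element_eq:
  assumes "w\<^sub>0 \<in> W" and neg: "\<And>\<beta>. \<beta> \<in> R \<Longrightarrow> \<beta> \<bullet> \<rho> > 0 \<Longrightarrow> w\<^sub>0 \<beta> \<bullet> \<rho> < 0"
  shows "longest_element W (reflection ` D) = w\<^sub>0"
  unfolding longest_element_def
proof (rule the_equality)
  have inv_w0: "inversions w\<^sub>0 = {\<beta> \<in> R. \<beta> \<bullet> \<rho> > 0}" using neg by (auto simp: inversions_def)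
  have le: "card (inversions v) \<le> card (inversions w\<^sub>0)" for v
    unfolding inv_w0 using finite_R by (intro card_mono) (auto simp: inversions_def)
  then show "w\<^sub>0 \<in> W \<and>
    (\<forall>v\<in>W. word_length (reflection ` D) v \<le> word_length (reflection ` D) w\<^sub>0)"
    using assms(1) by (simp add: word_length_eq_card_inversions)
  have comp_w0: "w \<circ> w\<^sub>0 = id" if "w \<in> W" and w: "\<And>\<beta>. \<beta> \<in> R \<Longrightarrow> \<beta> \<bullet> \<rho> > 0 \<Longrightarrow> w \<beta> \<bullet> \<rho> < 0" for w
  proof (rule ccontr)
    assume "w \<circ> w\<^sub>0 \<noteq> id"
    then obtain \<alpha> where \<alpha>: "\<alpha> \<in> D" "w (w\<^sub>0 \<alpha>) \<bullet> \<rho> < 0"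
      using ex_descent[OF comp_W[OF \<open>w \<in> W\<close> assms(1)]] by auto
    have "w (- w\<^sub>0 \<alpha>) \<bullet> \<rho> < 0"
      using w[of "- w\<^sub>0 \<alpha>"] neg[of \<alpha>] \<alpha> D_subset D_pos uminus_R W_R[OF assms(1)] by auto
    then show False using \<alpha>(2) linear_neg[OF linear_W[OF \<open>w \<in> W\<close>], of "w\<^sub>0 \<alpha>"] by simp
  qed
  fix w assume w: "w \<in> W \<and> (\<forall>v\<in>W. word_length (reflection ` D) v \<le> word_length (reflection ` D) w)"
  then have "card (inversions w\<^sub>0) \<le> card (inversions w)"
    using assms(1) by (metis word_length_eq_card_inversions)
  then have "inversions w = inversions w\<^sub>0"
    using finite_R unfolding inv_w0 by (intro card_seteq) (auto simp: inversions_def)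
  then have "w \<circ> w\<^sub>0 = id" using comp_w0[of w] w unfolding inv_w0 by (auto simp: inversions_def)
  moreover have "w\<^sub>0 \<circ> w\<^sub>0 = id" using comp_w0[of w\<^sub>0] assms by blast
  ultimately show "w = w\<^sub>0" by (metis comp_assoc comp_id id_comp)
qed

end

section \<open>Signed permutations of the standard basis\<close>

definition signed_basis :: "'a::euclidean_space set" where
  "signed_basis = Basis \<union> uminus ` Basis"

definition signed_permutations :: "('a::euclidean_space \<Rightarrow> 'a) set" where
  "signed_permutations = {w. linear w \<and> inj w \<and> w ` signed_basis \<subseteq> signed_basis}"

definition basis_permutations :: "('a::euclidean_space \<Rightarrow> 'a) set" where
  "basis_permutations = {w. linear w \<and> inj w \<and> w ` Basis \<subseteq> Basis}"

text \<open>Writing the roots as the nonzero sums of two signed basis vectors absorbs the long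
  roots and makes invariance under signed permutations immediate.\<close>

definition roots_C :: "'a::euclidean_space set" where
  "roots_C = {u + v | u v. u \<in> signed_basis \<and> v \<in> signed_basis} - {0}"

definition roots_A :: "'a::euclidean_space set" where
  "roots_A = {b - c | b c. b \<in> Basis \<and> c \<in> Basis} - {0}"

lemma finite_signed_basis: "finite signed_basis"
  by (simp add: signed_basis_def)

lemma uminus_signed_basis: "u \<in> signed_basis \<Longrightarrow> - u \<in> signed_basis"
  by (auto simp: signed_basis_def)

lemma inner_signed_basis:
  assumes "u \<in> signed_basis" "v \<in> signed_basis"
  shows "u \<bullet> v = (if u = v then 1 else if u = - v then -1 else 0)"
proof -
  have "b \<noteq> - c" if "b \<in> Basis" "c \<in> Basis" for b c :: 'a
  proof
    assume "b = - c"
    then have "b \<bullet> c = - 1" using that by (simp add: inner_Basis)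
    then show False using that by (simp add: inner_Basis split: if_splits)
  qed
  moreover have "- b \<noteq> c" if "b \<in> Basis" "c \<in> Basis" for b c :: 'a
    using calculation[OF that(2,1)] by metis
  ultimately show ?thesis
    using assms by (auto simp: signed_basis_def inner_Basis)
qed

lemma basis_permutations_subset: "basis_permutations \<subseteq> signed_permutations"
  by (auto simp: basis_permutations_def signed_permutations_def signed_basis_def linear_neg
      image_subset_iff)

text \<open>The reflection exchanges \<open>u\<close> with \<open>- v\<close> and \<open>v\<close> with \<open>- u\<close>, also when
  \<open>u = v\<close>, and fixes all signed basis vectors orthogonal to both.\<close>

lemma reflection_in_signed_permutations:
  assumes "u \<in> signed_basis" "v \<in> signed_basis" "u + v \<noteq> 0"
  shows "reflection (u + v) \<in> signed_permutations"
proof -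
  have nz: "u \<noteq> 0" "v \<noteq> 0"
    using inner_signed_basis[OF assms(1,1)] inner_signed_basis[OF assms(2,2)] by auto
  have "reflection (u + v) x \<in> signed_basis" if x: "x \<in> signed_basis" for x
  proof (cases "x = u \<or> x = - u \<or> x = v \<or> x = - v")
    case True
    have uv: "u \<noteq> - v" using assms(3) by auto
    have d: "u \<bullet> v = (if u = v then 1 else 0)" "u \<bullet> u = 1" "v \<bullet> v = 1"
      using inner_signed_basis[OF assms(1,2)] inner_signed_basis[OF assms(1,1)]
        inner_signed_basis[OF assms(2,2)] uv by auto
    have n: "(u + v) \<bullet> (u + v) = 2 * (1 + u \<bullet> v)" "1 + u \<bullet> v \<noteq> 0"
      using d by (auto simp: inner_add inner_commute)
    have u: "reflection (u + v) u = - v"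
      using d n by (simp add: reflection_def inner_add inner_commute)
    have v: "reflection (u + v) v = - u"
      using d n by (simp add: reflection_def inner_add inner_commute)
    have "reflection (u + v) (- u) = v" "reflection (u + v) (- v) = u"
      unfolding linear_neg[OF linear_reflection] u v by simp_all
    then have "reflection (u + v) x \<in> {u, v, - u, - v}"
      using True u v by blast
    moreover have "{u, v, - u, - v} \<subseteq> signed_basis"
      using assms(1,2) by (simp add: uminus_signed_basis)
    ultimately show ?thesis by (rule subsetD[rotated])
  next
    case False
    then have "x \<bullet> u = 0" "x \<bullet> v = 0"
      using inner_signed_basis[OF x assms(1)] inner_signed_basis[OF x assms(2)] by auto
    then have "reflection (u + v) x = x" by (simp add: reflection_def inner_add_right)
    then show ?thesis using x by simp
  qed
  then show ?thesis
    using assms(3) by (auto simp: signed_permutations_def linear_reflection inj_reflection)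
qed

text \<open>The reflection is the transposition of \<open>b\<close> and \<open>c\<close>.\<close>

lemma reflection_in_basis_permutations:
  assumes "b \<in> Basis" "c \<in> Basis" "b \<noteq> c"
  shows "reflection (b - c) \<in> basis_permutations"
proof -
  have n: "(b - c) \<bullet> (b - c) = 2"
    using assms by (simp add: inner_diff inner_Basis)
  have "reflection (b - c) x \<in> Basis" if x: "x \<in> Basis" for x
  proof -
    have "reflection (b - c) x = (if x = b then c else if x = c then b else x)"
      using assms x unfolding reflection_def n by (simp add: inner_diff_right inner_Basis)
    then show ?thesis using assms x by simp
  qed
  then show ?thesis
    using assms(3) by (auto simp: basis_permutations_def linear_reflection inj_reflection)
qed

lemma
  shows id_in_signed_permutations: "id \<in> signed_permutations"
    and comp_in_signed_permutations:
      "v \<in> signed_permutations \<Longrightarrow> w \<in> signed_permutations \<Longrightarrow> v \<circ> w \<in> signed_permutations"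
    and id_in_basis_permutations: "id \<in> basis_permutations"
    and comp_in_basis_permutations:
      "v \<in> basis_permutations \<Longrightarrow> w \<in> basis_permutations \<Longrightarrow> v \<circ> w \<in> basis_permutations"
  by (auto simp: signed_permutations_def basis_permutations_def linear_id inj_compose
      linear_compose image_subset_iff)

lemma signed_permutations_roots:
  assumes w: "w \<in> signed_permutations" and "\<beta> \<in> roots_C"
  shows "w \<beta> \<in> roots_C"
proof -
  obtain u v where uv: "u \<in> signed_basis" "v \<in> signed_basis" "\<beta> = u + v" "\<beta> \<noteq> 0"
    using assms(2) by (auto simp: roots_C_def)
  have "w \<beta> = w u + w v" "w \<beta> \<noteq> 0"
    using w uv by (auto simp: signed_permutations_def linear_add linear_injective_0)
  moreover have "w u \<in> signed_basis" "w v \<in> signed_basis"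
    using w uv by (auto simp: signed_permutations_def)
  ultimately show ?thesis by (auto simp: roots_C_def)
qed

lemma basis_permutations_roots:
  assumes w: "w \<in> basis_permutations" and "\<beta> \<in> roots_A"
  shows "w \<beta> \<in> roots_A"
proof -
  obtain b c where bc: "b \<in> Basis" "c \<in> Basis" "\<beta> = b - c" "\<beta> \<noteq> 0"
    using assms(2) by (auto simp: roots_A_def)
  have "w \<beta> = w b - w c" "w \<beta> \<noteq> 0"
    using w bc by (auto simp: basis_permutations_def linear_diff dest: injD)
  moreover have "w b \<in> Basis" "w c \<in> Basis"
    using w bc by (auto simp: basis_permutations_def)
  ultimately show ?thesis by (auto simp: roots_A_def)
qed

lemma finite_roots_C: "finite roots_C"
proof -
  have "roots_C \<subseteq> (\<lambda>(u, v). u + v) ` (signed_basis \<times> signed_basis)"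
    by (auto simp: roots_C_def)
  then show ?thesis by (rule finite_subset) (simp add: finite_signed_basis)
qed

lemma uminus_roots_C: "\<beta> \<in> roots_C \<Longrightarrow> - \<beta> \<in> roots_C"
  unfolding roots_C_def
  by (auto simp del: minus_add_distrib simp: minus_add_distrib[symmetric])
    (metis minus_add_distrib uminus_signed_basis)

lemma roots_A_subset: "roots_A \<subseteq> roots_C"
proof
  fix \<beta> :: 'a assume "\<beta> \<in> roots_A"
  then obtain b c where "b \<in> Basis" "c \<in> Basis" "\<beta> = b + (- c)" "\<beta> \<noteq> 0"
    by (auto simp: roots_A_def)
  then show "\<beta> \<in> roots_C" unfolding roots_C_def signed_basis_def by blast
qed

lemma uminus_roots_A: "\<beta> \<in> roots_A \<Longrightarrow> - \<beta> \<in> roots_A"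
  by (auto simp: roots_A_def) (metis minus_diff_eq)

section \<open>The simple roots of types C and A\<close>

locale ordered_basis =
  fixes e :: "nat \<Rightarrow> 'a::euclidean_space" and l :: nat
  assumes bij_e: "bij_betw e {1..l} Basis"
begin

text \<open>Half the sum of the positive roots of type \<open>C\<close>.\<close>

definition rho :: 'a where
  "rho = (\<Sum>p = 1..l. real (l + 1 - p) *\<^sub>R e p)"

lemma e_Basis: "p \<in> {1..l} \<Longrightarrow> e p \<in> Basis"
  using bij_e by (auto simp: bij_betw_def)

lemma Basis_eq: "Basis = e ` {1..l}"
  using bij_e by (simp add: bij_betw_def)

lemma signed_basis_eq: "signed_basis = {s *\<^sub>R e p | s p. s \<in> {1, -1} \<and> p \<in> {1..l}}"
  unfolding signed_basis_def Basis_eq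
  by (auto simp: image_iff) (metis atLeastAtMost_iff scaleR_minus1_left scaleR_one)+

lemma inner_e: "p \<in> {1..l} \<Longrightarrow> q \<in> {1..l} \<Longrightarrow> e p \<bullet> e q = of_bool (p = q)"
  using bij_e e_Basis by (auto simp: bij_betw_def inner_Basis inj_on_eq_iff)

lemma l_pos: "1 \<le> l"
  using Basis_eq nonempty_Basis by fastforce

lemma inner_sum_e:
  assumes "p \<in> {1..l}"
  shows "e p \<bullet> (\<Sum>q = 1..l. f q *\<^sub>R e q) = f p"
proof -
  have "e p \<bullet> (\<Sum>q = 1..l. f q *\<^sub>R e q) = (\<Sum>q = 1..l. if q = p then f q else 0)"
    unfolding inner_sum_right by (intro sum.cong) (use assms inner_e in auto)
  then show ?thesis using assms by simp
qed

lemma inner_e_rho: "p \<in> {1..l} \<Longrightarrow> e p \<bullet> rho = real (l + 1 - p)"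
  unfolding rho_def by (rule inner_sum_e)

lemma rho_diff: "p \<in> {1..l} \<Longrightarrow> q \<in> {1..l} \<Longrightarrow> (e p - e q) \<bullet> rho = real q - real p"
  by (simp add: inner_diff_left inner_e_rho of_nat_diff)

lemma rho_add: "p \<in> {1..l} \<Longrightarrow> q \<in> {1..l} \<Longrightarrow> (e p + e q) \<bullet> rho = 2 * real l + 2 - real p - real q"
  by (simp add: inner_add_left inner_e_rho of_nat_diff)

text \<open>Signed basis vectors are distinguished by their inner products with \<open>rho\<close>.\<close>

lemma signed_basis_eqI:
  "p \<in> {1..l} \<Longrightarrow> u \<in> signed_basis \<Longrightarrow> u \<bullet> rho = real (l + 1 - p) \<Longrightarrow> u = e p"
  by (auto simp: signed_basis_eq inner_e_rho)

lemma roots_C_cases: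
  assumes "\<beta> \<in> roots_C"
  obtains (diff) p q where "p \<in> {1..l}" "q \<in> {1..l}" "p \<noteq> q" "\<beta> = e p - e q"
    | (sum) p q where "p \<in> {1..l}" "q \<in> {1..l}" "p \<le> q" "\<beta> = e p + e q"
    | (neg_sum) p q where "p \<in> {1..l}" "q \<in> {1..l}" "p \<le> q" "\<beta> = - (e p + e q)"
proof -
  obtain s t p q where *: "s \<in> {1, -1}" "t \<in> {1, -1}" "p \<in> {1..l}" "q \<in> {1..l}"
    "\<beta> = s *\<^sub>R e p + t *\<^sub>R e q" "\<beta> \<noteq> 0"
    using assms unfolding roots_C_def signed_basis_eq by blast
  consider "s = 1" "t = 1" | "s = 1" "t = -1" | "s = -1" "t = 1" | "s = -1" "t = -1"
    using * by auto
  then show thesis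
  proof cases
    case 1
    then show thesis using * sum[of p q] sum[of q p] by (cases "p \<le> q") (auto simp: add.commute)
  next
    case 2
    then show thesis using * diff[of p q] by auto
  next
    case 3
    then show thesis using * diff[of q p] by auto
  next
    case 4
    then show thesis using * neg_sum[of p q] neg_sum[of q p]
      by (cases "p \<le> q") (auto simp: add.commute)
  qed
qed

lemma e_add_e_neq_0: "p \<in> {1..l} \<Longrightarrow> q \<in> {1..l} \<Longrightarrow> e p + e q \<noteq> 0"
  using rho_add[of p q] by auto

lemma type_C_roots_eq: "type_C_roots e l = roots_C"
proof
  show "type_C_roots e l \<subseteq> roots_C"
  proof
    fix \<beta> assume "\<beta> \<in> type_C_roots e l"
    then consider s p where "s \<in> {1, -1::real}" "p \<in> {1..l}" "\<beta> = s *\<^sub>R (2 *\<^sub>R e p)"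
      | s t p q where "s \<in> {1, -1::real}" "t \<in> {1, -1::real}" "p \<in> {1..l}" "q \<in> {1..l}" "p < q"
        "\<beta> = s *\<^sub>R e p + t *\<^sub>R e q"
      unfolding type_C_roots_def by blast
    then show "\<beta> \<in> roots_C"
    proof cases
      case 1
      then have "\<beta> = s *\<^sub>R e p + s *\<^sub>R e p" "\<beta> \<noteq> 0"
        using e_add_e_neq_0[of p p] by (auto simp: scaleR_2[symmetric] mult.commute)
      then show ?thesis using 1 unfolding roots_C_def signed_basis_eq by blast
    next
      case 2
      then have "\<beta> \<bullet> rho = s * real (l + 1 - p) + t * real (l + 1 - q)"
        by (simp add: inner_add_left inner_e_rho)
      then have "\<beta> \<bullet> rho \<noteq> 0" using 2 by (auto simp: of_nat_diff)
      then have "\<beta> \<noteq> 0" by auto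
      then show ?thesis using 2 unfolding roots_C_def signed_basis_eq by blast
    qed
  qed
  show "roots_C \<subseteq> type_C_roots e l"
  proof
    fix \<beta> :: 'a assume "\<beta> \<in> roots_C"
    then show "\<beta> \<in> type_C_roots e l"
    proof (cases rule: roots_C_cases)
      case (diff p q)
      then show ?thesis
      proof (cases "p < q")
        case True
        then have "\<beta> = 1 *\<^sub>R e p + (-1) *\<^sub>R e q" using diff by simp
        then show ?thesis using diff True unfolding type_C_roots_def by blast
      next
        case False
        then have "q < p" "\<beta> = (-1) *\<^sub>R e q + 1 *\<^sub>R e p" using diff by auto
        then show ?thesis using diff unfolding type_C_roots_def by blast
      qed
    next
      case (sum p q)
      then have "p = q \<and> \<beta> = 1 *\<^sub>R (2 *\<^sub>R e p) \<or> p < q \<and> \<beta> = 1 *\<^sub>R e p + 1 *\<^sub>R e q"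
        by (auto simp: scaleR_2)
      then show ?thesis using sum unfolding type_C_roots_def by blast
    next
      case (neg_sum p q)
      then have "p = q \<and> \<beta> = (-1) *\<^sub>R (2 *\<^sub>R e p) \<or> p < q \<and> \<beta> = (-1) *\<^sub>R e p + (-1) *\<^sub>R e q"
        by (auto simp: scaleR_2)
      then show ?thesis using neg_sum unfolding type_C_roots_def by blast
    qed
  qed
qed

lemma simple_root_pos: "i \<in> {1..l} \<Longrightarrow> simple_root e l i \<bullet> rho > 0"
  using rho_diff[of i "i + 1"] inner_e_rho[of l] l_pos by (auto simp: simple_root_def)

text \<open>Equivalent to the familiar fact that a simple reflection maps \<open>rho\<close> to \<open>rho - \<alpha>\<close>.\<close>

lemma reflection_simple_root_rho:
  assumes i: "i \<in> {1..l}"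
  shows "reflection (simple_root e l i) x \<bullet> rho = x \<bullet> rho - x \<bullet> simple_root e l i"
proof -
  have "simple_root e l i \<bullet> simple_root e l i = 2 * (simple_root e l i \<bullet> rho)"
    "simple_root e l i \<bullet> simple_root e l i \<noteq> 0"
  proof -
    show "simple_root e l i \<bullet> simple_root e l i = 2 * (simple_root e l i \<bullet> rho)"
      using i by (auto simp: simple_root_def inner_diff inner_e inner_e_rho)
    show "simple_root e l i \<bullet> simple_root e l i \<noteq> 0" using simple_root_pos[OF i] by auto
  qed
  then show ?thesis by (simp add: reflection_def inner_diff_left)
qed

lemma roots_C_pos_cases:
  assumes "\<beta> \<in> roots_C" "\<beta> \<bullet> rho > 0"
  obtains (diff) p q where "p \<in> {1..l}" "q \<in> {1..l}" "p < q" "\<beta> = e p - e q"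
    | (sum) p q where "p \<in> {1..l}" "q \<in> {1..l}" "p \<le> q" "\<beta> = e p + e q"
  using assms(1)
proof (cases rule: roots_C_cases)
  case (neg_sum p q)
  then show thesis using assms(2) rho_add[of p q] by (simp del: minus_add_distrib)
next
  case (diff p q)
  then show thesis using assms(2) rho_diff[of p q] that(1)[of p q] by simp
qed (use that in blast)

text \<open>With the previous formula this says that reflecting in a simple root \<open>\<alpha>\<close> keeps all positive
  roots except \<open>\<alpha>\<close> positive.  It is checked on coordinates.\<close>

lemma inner_simple_root_less:
  assumes "\<beta> \<in> roots_C" "\<beta> \<bullet> rho > 0" "i \<in> {1..l}" "\<beta> \<noteq> simple_root e l i"
  shows "\<beta> \<bullet> simple_root e l i < \<beta> \<bullet> rho"
  using assms(1,2)
proof (cases rule: roots_C_pos_cases)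
  case (diff p q)
  have rho: "\<beta> \<bullet> rho = real q - real p" using diff rho_diff by simp
  show ?thesis
  proof (cases "i < l")
    case True
    then have "\<beta> \<bullet> simple_root e l i
      = of_bool (p = i) - of_bool (p = i + 1) - of_bool (q = i) + of_bool (q = i + 1)"
      using diff assms(3) by (simp add: simple_root_def inner_diff inner_e)
    moreover have "\<not> (p = i \<and> q = i + 1)" using diff True assms(4) by (auto simp: simple_root_def)
    ultimately show ?thesis
      using rho \<open>p < q\<close> by (cases "p = i"; cases "q = i + 1") auto
  next
    case False
    then have "i = l" using assms(3) by simp
    then have "\<beta> \<bullet> simple_root e l i = 2 * of_bool (p = l) - 2 * of_bool (q = l)"
      using diff assms(3) by (simp add: simple_root_def inner_diff inner_e)
    then show ?thesis using rho diff by auto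
  qed
next
  case (sum p q)
  have rho: "\<beta> \<bullet> rho = 2 * real l + 2 - real p - real q" using sum rho_add by simp
  show ?thesis
  proof (cases "i < l")
    case True
    then have "\<beta> \<bullet> simple_root e l i
      = of_bool (p = i) - of_bool (p = i + 1) + of_bool (q = i) - of_bool (q = i + 1)"
      using sum assms(3) by (simp add: simple_root_def inner_diff inner_add inner_e)
    moreover have "real p \<le> real l" "real q \<le> real l" "real i < real l"
      using sum True by auto
    ultimately show ?thesis
      using rho by (cases "p = i"; cases "q = i") auto
  next
    case False
    then have "i = l" using assms(3) by simp
    then have "\<beta> \<bullet> simple_root e l i = 2 * of_bool (p = l) + 2 * of_bool (q = l)"
      using sum assms(3) by (simp add: simple_root_def inner_add inner_e)
    moreover have "p \<noteq> l" using sum assms(4) \<open>i = l\<close> by (auto simp: simple_root_def scaleR_2)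
    then have "real p < real l" "real q \<le> real l" using sum by auto
    ultimately show ?thesis using rho by (cases "q = l") auto
  qed
qed

lemma roots_C_regular:
  assumes "\<beta> \<in> roots_C"
  shows "\<beta> \<bullet> rho \<noteq> 0"
  using assms
proof (cases rule: roots_C_cases)
  case (diff p q) then show ?thesis using rho_diff[of p q] by simp
next
  case (sum p q) then show ?thesis using rho_add[of p q] by simp
next
  case (neg_sum p q) then show ?thesis using rho_add[of p q] by (simp del: minus_add_distrib)
qed

text \<open>The heights \<open>k i\<close> of \<open>w (e i)\<close> are integers with \<open>l \<ge> k 1 > \<dots> > k l > 0\<close>: differences
  of neighbours are the heights of the images of the simple roots.  There are \<open>l\<close> of them, so
  \<open>k i = l + 1 - i\<close>.\<close>

lemma signed_permutation_eq_id:
  assumes w: "w \<in> signed_permutations"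
    and asc: "\<And>i. i \<in> {1..l} \<Longrightarrow> w (simple_root e l i) \<bullet> rho > 0"
  shows "w = id"
proof -
  have lin: "linear w" using w by (simp add: signed_permutations_def)
  have wU: "w (e i) \<in> signed_basis" if "i \<in> {1..l}" for i
    using w e_Basis[OF that] by (auto simp: signed_permutations_def signed_basis_def)
  have "\<exists>k::int. w (e i) \<bullet> rho = of_int k \<and> k \<le> int l" if i: "i \<in> {1..l}" for i
  proof -
    obtain s p where sp: "s \<in> {1, -1::real}" "p \<in> {1..l}" "w (e i) = s *\<^sub>R e p"
      using wU[OF i] unfolding signed_basis_eq by blast
    then show ?thesis
      by (intro exI[of _ "if s = 1 then int (l + 1 - p) else - int (l + 1 - p)"])
        (auto simp: inner_e_rho of_nat_diff)
  qed
  then obtain k :: "nat \<Rightarrow> int" where k: "\<And>i. i \<in> {1..l} \<Longrightarrow> w (e i) \<bullet> rho = of_int (k i)"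
    and k_le: "\<And>i. i \<in> {1..l} \<Longrightarrow> k i \<le> int l"
    by metis
  have dec: "k (i + 1) + 1 \<le> k i" if "i \<in> {1..l}" "i < l" for i
    using asc[of i] that k[of i] k[of "i + 1"]
    by (simp add: simple_root_def linear_diff[OF lin] inner_diff_left)
  have last: "1 \<le> k l"
    using asc[of l] l_pos k[of l] by (simp add: simple_root_def linear_scale[OF lin])
  have ge: "i \<le> l \<Longrightarrow> 1 \<le> i \<Longrightarrow> int (l + 1 - i) \<le> k i" for i
  proof (induction i rule: inc_induct)
    case base then show ?case using last by simp
  next
    case (step i) then show ?case using dec[of i] by simp
  qed
  have le: "1 \<le> i \<Longrightarrow> i \<le> l \<Longrightarrow> k i \<le> int (l + 1 - i)" for i
  proof (induction i rule: dec_induct)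
    case base then show ?case using k_le l_pos by simp
  next
    case (step i) then show ?case using dec[of i] by simp
  qed
  have "w (e i) = e i" if i: "i \<in> {1..l}" for i
  proof (rule signed_basis_eqI[OF i wU[OF i]])
    have "k i = int (l + 1 - i)" using ge[of i] le[of i] i by (intro antisym) auto
    then show "w (e i) \<bullet> rho = real (l + 1 - i)" using k[OF i] by simp
  qed
  then show ?thesis
    by (intro linear_eq_stdbasis[OF lin linear_id]) (auto simp: Basis_eq)
qed

lemma simple_root_roots_C:
  assumes "i \<in> {1..l}"
  shows "simple_root e l i \<in> roots_C"
proof (cases "i < l")
  case True
  then have "simple_root e l i = 1 *\<^sub>R e i + (-1) *\<^sub>R e (i + 1)" "i + 1 \<in> {1..l}"
    by (auto simp: simple_root_def)
  moreover have "simple_root e l i \<noteq> 0" using simple_root_pos[OF assms] by auto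
  ultimately show ?thesis using assms unfolding roots_C_def signed_basis_eq by blast
next
  case False
  then have "simple_root e l i = 1 *\<^sub>R e l + 1 *\<^sub>R e l" "l \<in> {1..l}"
    using l_pos by (auto simp: simple_root_def scaleR_2)
  moreover have "simple_root e l i \<noteq> 0" using simple_root_pos[OF assms] by auto
  ultimately show ?thesis using assms unfolding roots_C_def signed_basis_eq by blast
qed

lemma simple_root_roots_A:
  assumes "i \<in> {1..l - 1}"
  shows "simple_root e l i \<in> roots_A"
proof -
  have "simple_root e l i = e i - e (i + 1)" "simple_root e l i \<noteq> 0"
    using assms simple_root_pos[of i] by (auto simp: simple_root_def)
  moreover have "e i \<in> Basis" "e (i + 1) \<in> Basis" using assms by (auto intro: e_Basis)
  ultimately show ?thesis unfolding roots_A_def by blast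
qed

lemma reflection_roots_C: "\<beta> \<in> roots_C \<Longrightarrow> reflection \<beta> \<in> signed_permutations"
  using reflection_in_signed_permutations by (auto simp: roots_C_def)

lemma reflection_roots_A: "\<beta> \<in> roots_A \<Longrightarrow> reflection \<beta> \<in> basis_permutations"
  using reflection_in_basis_permutations by (auto simp: roots_A_def)

sublocale C: reflection_group roots_C "simple_root e l ` {1..l}" rho signed_permutations
proof (rule reflection_group.intro)
  fix w :: "'a \<Rightarrow> 'a" assume w: "w \<in> signed_permutations" "w \<noteq> id"
  then obtain i where "i \<in> {1..l}" "\<not> w (simple_root e l i) \<bullet> rho > 0"
    using signed_permutation_eq_id by blast
  moreover have "w (simple_root e l i) \<bullet> rho \<noteq> 0"
    using roots_C_regular signed_permutations_roots[OF w(1)] simple_root_roots_C calculation(1) by blast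
  ultimately show "\<exists>\<alpha>\<in>simple_root e l ` {1..l}. w \<alpha> \<bullet> rho < 0" by force
qed (auto simp: finite_roots_C uminus_roots_C roots_C_regular simple_root_roots_C simple_root_pos
    reflection_simple_root_rho inner_simple_root_less reflection_roots_C signed_permutations_roots
    id_in_signed_permutations intro: comp_in_signed_permutations,
    auto simp: signed_permutations_def)

text \<open>The last simple root \<open>2 e l\<close> of type \<open>C\<close> does not belong to this subsystem, but a
  permutation keeps it positive, so the criterion for the identity established for signed
  permutations still applies.\<close>

sublocale A: reflection_group roots_A "simple_root e l ` {1..l - 1}" rho basis_permutations
proof (rule reflection_group.intro)
  fix w :: "'a \<Rightarrow> 'a" assume w: "w \<in> basis_permutations" "w \<noteq> id"
  then obtain i where i: "i \<in> {1..l}" "\<not> w (simple_root e l i) \<bullet> rho > 0"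
    using signed_permutation_eq_id basis_permutations_subset by blast
  have "w (simple_root e l l) \<bullet> rho > 0"
  proof -
    have "w (e l) \<in> Basis" using w e_Basis[of l] l_pos by (auto simp: basis_permutations_def)
    then obtain q where "q \<in> {1..l}" "w (e l) = e q" unfolding Basis_eq by blast
    moreover have "w (2 *\<^sub>R e l) = 2 *\<^sub>R w (e l)"
      using w by (simp add: basis_permutations_def linear_scale)
    ultimately show ?thesis by (simp add: simple_root_def inner_e_rho)
  qed
  then have "i \<noteq> l" using i by auto
  then have i': "i \<in> {1..l - 1}" using i by auto
  have "w (simple_root e l i) \<bullet> rho \<noteq> 0"
    using roots_C_regular roots_A_subset basis_permutations_roots[OF w(1)] simple_root_roots_A[OF i']
    by blast
  then show "\<exists>\<alpha>\<in>simple_root e l ` {1..l - 1}. w \<alpha> \<bullet> rho < 0" using i i' by force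
next
  fix \<alpha> \<beta> :: 'a assume "\<alpha> \<in> simple_root e l ` {1..l - 1}" "\<beta> \<in> roots_A" "\<beta> \<bullet> rho > 0" "\<beta> \<noteq> \<alpha>"
  then show "reflection \<alpha> \<beta> \<bullet> rho > 0"
    using C.reflection_pos[of \<alpha> \<beta>] roots_A_subset by fastforce
next
  show "finite roots_A" using finite_subset[OF roots_A_subset finite_roots_C] .
next
  fix \<beta> :: 'a assume "\<beta> \<in> roots_A"
  then show "\<beta> \<bullet> rho \<noteq> 0" using roots_C_regular roots_A_subset by blast
qed (auto simp: uminus_roots_A simple_root_roots_A simple_root_pos
    reflection_roots_A basis_permutations_roots
    id_in_basis_permutations intro: comp_in_basis_permutations,
    auto simp: basis_permutations_def)

section \<open>The longest elements and omega\<close>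

lemma weyl_group_eq: "weyl_group e l = signed_permutations"
  unfolding weyl_group_def type_C_roots_eq
proof (rule C.generated_group_eq)
  show "reflection ` simple_root e l ` {1..l} \<subseteq> reflection ` roots_C"
    using C.D_subset by blast
  show "reflection ` roots_C \<subseteq> signed_permutations"
    using reflection_roots_C by blast
  show "s \<circ> s = id" if "s \<in> reflection ` roots_C" for s :: "'a \<Rightarrow> 'a"
    using that by (auto simp: roots_C_def reflection_comp_reflection)
qed

lemma parabolic_subgroup_eq:
  "generated_group (simple_reflections e l {1..l - 1}) = basis_permutations"
  unfolding simple_reflections_def image_image[symmetric]
  by (rule A.generated_group_eq) (use A.reflection_W A.D_nonzero reflection_comp_reflection in auto)

lemma w_zero_eq: "w_zero e l = uminus"
  unfolding w_zero_def weyl_group_eq simple_reflections_def image_image[symmetric]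
  by (rule C.longest_element_eq)
    (auto simp: signed_permutations_def uminus_signed_basis linear_uminus)

text \<open>The linear extension of \<open>e p \<mapsto> e (l + 1 - p)\<close>.\<close>

definition reversal :: "'a \<Rightarrow> 'a" where
  "reversal x = (\<Sum>p = 1..l. (x \<bullet> e p) *\<^sub>R e (l + 1 - p))"

lemma linear_reversal: "linear reversal"
  by (rule linearI)
    (simp_all add: reversal_def inner_add_left scaleR_add_left sum.distrib scaleR_sum_right)

lemma reflected_index: "p \<in> {1..l} \<Longrightarrow> l + 1 - p \<in> {1..l}"
  by auto

lemma reversal_e:
  assumes "p \<in> {1..l}"
  shows "reversal (e p) = e (l + 1 - p)"
proof -
  have "reversal (e p) = (\<Sum>q = 1..l. if q = p then e (l + 1 - q) else 0)"
    unfolding reversal_def by (intro sum.cong) (use assms inner_e in auto)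
  then show ?thesis using assms by simp
qed

lemma reversal_reversal: "reversal \<circ> reversal = id"
proof (intro linear_eq_stdbasis linear_id linear_compose[OF linear_reversal linear_reversal])
  fix b :: 'a assume "b \<in> Basis"
  then obtain p where p: "p \<in> {1..l}" "b = e p" unfolding Basis_eq by blast
  then have "l + 1 - p \<in> {1..l}" "l + 1 - (l + 1 - p) = p" by auto
  then show "(reversal \<circ> reversal) b = id b"
    using p reversal_e[of p] reversal_e[of "l + 1 - p"] by simp
qed

lemma reversal_in_basis_permutations: "reversal \<in> basis_permutations"
proof -
  have "reversal b \<in> Basis" if "b \<in> Basis" for b
  proof -
    from that obtain p where "p \<in> {1..l}" "b = e p" unfolding Basis_eq by blast
    then show ?thesis using reversal_e[of p] e_Basis[OF reflected_index, of p] by simp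
  qed
  moreover have "inj reversal"
    using bij_comp_self_id[OF reversal_reversal] by (rule bij_is_inj)
  ultimately show ?thesis by (auto simp: basis_permutations_def linear_reversal)
qed

lemma w_ell_eq: "w_ell e l = reversal"
  unfolding w_ell_def parabolic_subgroup_eq
  unfolding simple_reflections_def image_image[symmetric]
proof (rule A.longest_element_eq[OF reversal_in_basis_permutations])
  fix \<beta> :: 'a assume \<beta>: "\<beta> \<in> roots_A" "\<beta> \<bullet> rho > 0"
  then obtain p q where pq: "p \<in> {1..l}" "q \<in> {1..l}" "\<beta> = e p - e q"
    unfolding roots_A_def Basis_eq by blast
  then have "reversal \<beta> = e (l + 1 - p) - e (l + 1 - q)"
    by (simp add: linear_diff[OF linear_reversal] reversal_e)
  moreover have "p < q" using \<beta> pq rho_diff[of p q] by simp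
  ultimately show "reversal \<beta> \<bullet> rho < 0"
    using pq rho_diff[OF reflected_index reflected_index, of p q] by (simp add: of_nat_diff)
qed

lemma omega_eq: "omega e l x = - reversal x"
  by (simp add: omega_def w_zero_eq w_ell_eq linear_neg[OF linear_reversal])

lemma omega_omega: "omega e l (omega e l x) = x"
  using fun_cong[OF reversal_reversal, of x]
  by (simp add: omega_eq linear_neg[OF linear_reversal])

lemma omega_neq_id: "omega e l \<noteq> id"
proof
  assume "omega e l = id"
  then have "omega e l (e 1) = e 1" by simp
  then have "e 1 + e l = 0"
    using l_pos reversal_e[of 1] by (simp add: omega_eq neg_eq_iff_add_eq_0 add.commute)
  then show False using e_add_e_neq_0[of 1 l] l_pos by simp
qed

text \<open>The order of \<open>omega\<close> must be known to be exactly \<open>2\<close>, since the average is taken over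
  that many powers.\<close>

lemma average_omega: "average (omega e l) x = (1 / 2) *\<^sub>R (x - reversal x)"
proof -
  have "group.ord (BijGroup UNIV) (omega e l) = 2"
    by (intro ord_BijGroup_involution omega_neq_id) (auto simp: fun_eq_iff omega_omega)
  moreover have "(\<Sum>t = 1..2::nat. (omega e l ^^ t) x) = omega e l x + omega e l (omega e l x)"
    by (simp add: numeral_2_eq_2)
  ultimately show ?thesis by (simp add: average_def omega_omega) (simp add: omega_eq)
qed

lemma average_omega_eq_0: "average (omega e l) x = 0 \<longleftrightarrow> reversal x = x"
  by (auto simp: average_omega)

section \<open>Roots averaging to zero\<close>

text \<open>Compare the coordinates of both sides at \<open>e p\<close> and \<open>e q\<close>.  Either the reversal exchanges
  the two indices, or it fixes each of them; then both are the midpoint \<open>(l + 1) / 2\<close>, which is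
  its own mirror image.\<close>

lemma reversal_sum_fixed:
  assumes "p \<in> {1..l}" "q \<in> {1..l}" "reversal (e p + e q) = e p + e q"
  shows "q = l + 1 - p"
proof -
  have eq: "e (l + 1 - p) + e (l + 1 - q) = e p + e q"
    using assms by (simp add: linear_add[OF linear_reversal] reversal_e)
  have mem: "l + 1 - p \<in> {1..l}" "l + 1 - q \<in> {1..l}" using assms by auto
  have "e p \<bullet> (e (l + 1 - p) + e (l + 1 - q)) = e p \<bullet> (e p + e q)"
    "e q \<bullet> (e (l + 1 - p) + e (l + 1 - q)) = e q \<bullet> (e p + e q)"
    unfolding eq by simp_all
  then have p: "of_bool (p = l + 1 - p) + of_bool (p = l + 1 - q) = 1 + (of_bool (p = q) :: real)"
    and q: "of_bool (q = l + 1 - p) + of_bool (q = l + 1 - q) = of_bool (q = p) + (1 :: real)"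
    unfolding inner_add_right inner_e[OF assms(1) mem(1)] inner_e[OF assms(1) mem(2)]
      inner_e[OF assms(2) mem(1)] inner_e[OF assms(2) mem(2)] inner_e[OF assms(1,1)]
      inner_e[OF assms(1,2)] inner_e[OF assms(2,1)] inner_e[OF assms(2,2)] by simp_all
  show ?thesis
  proof (cases "p = q")
    case True
    then show ?thesis using p by (cases "p = l + 1 - p") auto
  next
    case False
    then have "p = l + 1 - p \<or> p = l + 1 - q" "q = l + 1 - p \<or> q = l + 1 - q"
      using p q by (auto simp: of_bool_def split: if_splits)
    then show ?thesis using False assms(1,2) by auto
  qed
qed

text \<open>A difference \<open>e p - e q\<close> cannot be fixed because the reversal negates its
  height.\<close>

lemma reversal_fixed_root:
  assumes "\<beta> \<in> roots_C" "reversal \<beta> = \<beta>"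
  obtains p s where "p \<in> {1..l}" "s \<in> {1, -1}" "\<beta> = s *\<^sub>R (e p + e (l + 1 - p))"
  using assms(1)
proof (cases rule: roots_C_cases)
  case (diff p q)
  then have "e (l + 1 - p) - e (l + 1 - q) = e p - e q"
    using assms(2) by (simp add: linear_diff[OF linear_reversal] reversal_e)
  then have "(e (l + 1 - p) - e (l + 1 - q)) \<bullet> rho = (e p - e q) \<bullet> rho" by simp
  then have "real (l + 1 - q) - real (l + 1 - p) = real q - real p"
    using diff rho_diff[OF reflected_index reflected_index, of p q] rho_diff[of p q] by simp
  then show thesis using diff by (simp add: of_nat_diff)
next
  case (sum p q)
  then show thesis
    using reversal_sum_fixed[of p q] assms(2) that[of p 1] by auto
next
  case (neg_sum p q)
  then have "reversal (e p + e q) = e p + e q"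
    using assms(2) linear_neg[OF linear_reversal, of "e p + e q"]
    by (simp del: minus_add_distrib)
  then show thesis
    using neg_sum reversal_sum_fixed[of p q] that[of p "-1"] by auto
qed

lemma reversal_symmetric_sum:
  assumes "p \<in> {1..l}"
  shows "reversal (e p + e (l + 1 - p)) = e p + e (l + 1 - p)"
proof -
  have "l + 1 - p \<in> {1..l}" "l + 1 - (l + 1 - p) = p" using assms by auto
  then show ?thesis
    using assms reversal_e[of "l + 1 - p"]
    by (simp add: linear_add[OF linear_reversal] reversal_e add.commute)
qed

lemma symmetric_sum_root:
  assumes "p \<in> {1..l}" "s \<in> {1, -1::real}"
  shows "s *\<^sub>R (e p + e (l + 1 - p)) \<in> roots_C"
proof -
  have "s *\<^sub>R (e p + e (l + 1 - p)) = s *\<^sub>R e p + s *\<^sub>R e (l + 1 - p)" "l + 1 - p \<in> {1..l}"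
    using assms by (auto simp: scaleR_add_right)
  moreover have "s *\<^sub>R (e p + e (l + 1 - p)) \<noteq> 0"
    using e_add_e_neq_0[OF assms(1) reflected_index[OF assms(1)]] assms(2) by auto
  ultimately show ?thesis using assms unfolding roots_C_def signed_basis_eq by blast
qed

lemma sum_simple_roots:
  "m \<le> n \<Longrightarrow> n \<le> l \<Longrightarrow> (\<Sum>k = m..<n. simple_root e l k) = e m - e n"
proof (induction n rule: dec_induct)
  case (step n)
  then show ?case by (simp add: simple_root_def)
qed simp

text \<open>The first sum telescopes to \<open>e i - e (l - i + 1)\<close>, the second one to
  \<open>2 (e (l - i + 1) - e l)\<close>.\<close>

lemma symmetric_sum_expansion:
  assumes "i \<in> {1..(l + 1) div 2}"
  shows "(\<Sum>k = i..l - i. simple_root e l k) + (\<Sum>k = l - i + 1..l - 1. 2 *\<^sub>R simple_root e l k)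
    + simple_root e l l = e i + e (l - i + 1)"
proof -
  have i: "1 \<le> i" "i \<le> l - i + 1" "l - i + 1 \<le> l" using assms l_pos by auto
  have "{i..l - i} = {i..<l - i + 1}" "{l - i + 1..l - 1} = {l - i + 1..<l}"
    using l_pos by auto
  then show ?thesis
    using sum_simple_roots[OF i(2,3)] sum_simple_roots[OF i(3) order.refl]
    by (simp only: scaleR_sum_right[symmetric]) (simp add: simple_root_def scaleR_2)
qed

lemma sum_of_bool_scaleR:
  assumes "S \<subseteq> {1..l}"
  shows "(\<Sum>k = 1..l. of_bool (k \<in> S) *\<^sub>R f k) = (\<Sum>k\<in>S. f k :: 'a)"
  using assms by (intro sum.mono_neutral_cong_right) auto

lemma symmetric_sum_positive:
  assumes "i \<in> {1..(l + 1) div 2}"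
  shows "e i + e (l - i + 1) \<in> positive_roots e l"
proof -
  \<comment> \<open>The coefficients of the expansion in \<open>symmetric_sum_expansion\<close>.\<close>
  let ?c = "\<lambda>k. of_bool (k \<in> {i..l - i}) + 2 * of_bool (k \<in> {l - i + 1..l - 1}) + of_bool (k \<in> {l}) :: nat"
  have sub: "{i..l - i} \<subseteq> {1..l}" "{l - i + 1..l - 1} \<subseteq> {1..l}" "{l} \<subseteq> {1..l}"
    using assms l_pos by auto
  have "(\<Sum>k = 1..l. real (?c k) *\<^sub>R simple_root e l k)
    = (\<Sum>k = 1..l. of_bool (k \<in> {i..l - i}) *\<^sub>R simple_root e l k)
      + (\<Sum>k = 1..l. of_bool (k \<in> {l - i + 1..l - 1}) *\<^sub>R (2 *\<^sub>R simple_root e l k))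
      + (\<Sum>k = 1..l. of_bool (k \<in> {l}) *\<^sub>R simple_root e l k)"
    unfolding sum.distrib[symmetric] by (intro sum.cong refl) (simp add: scaleR_add_left mult.commute)
  also have "\<dots> = e i + e (l - i + 1)"
    unfolding sum_of_bool_scaleR[OF sub(1)] sum_of_bool_scaleR[OF sub(2)] sum_of_bool_scaleR[OF sub(3)]
    using symmetric_sum_expansion[OF assms] by simp
  finally have "\<exists>c :: nat \<Rightarrow> nat. e i + e (l - i + 1) = (\<Sum>k = 1..l. real (c k) *\<^sub>R simple_root e l k)"
    by (intro exI[of _ ?c]) (rule sym)
  moreover have "e i + e (l - i + 1) \<in> type_C_roots e l"
    using symmetric_sum_root[of i 1] sub assms unfolding type_C_roots_eq
    by (cases "i \<le> l") (auto simp: Suc_diff_le)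
  ultimately show ?thesis by (simp add: positive_roots_def)
qed

text \<open>Used to exclude the negative roots among those fixed by the reversal; for this the weak
  inequality is enough, as no root has height zero.\<close>

lemma positive_roots_rho:
  assumes "\<beta> \<in> positive_roots e l"
  shows "\<beta> \<bullet> rho \<ge> 0"
proof -
  obtain c :: "nat \<Rightarrow> nat" where "\<beta> = (\<Sum>k = 1..l. real (c k) *\<^sub>R simple_root e l k)"
    using assms by (auto simp: positive_roots_def)
  then have "\<beta> \<bullet> rho = (\<Sum>k = 1..l. real (c k) * (simple_root e l k \<bullet> rho))"
    by (simp add: inner_sum_left)
  also have "\<dots> \<ge> 0" using simple_root_pos by (intro sum_nonneg mult_nonneg_nonneg) force+
  finally show ?thesis .
qed

lemma positive_roots_omega_0_eq:
  "positive_roots_omega_0 e l = {e p + e (l - p + 1) | p. p \<in> {1..(l + 1) div 2}}"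
proof
  show "positive_roots_omega_0 e l \<subseteq> {e p + e (l - p + 1) | p. p \<in> {1..(l + 1) div 2}}"
  proof
    fix \<beta> assume "\<beta> \<in> positive_roots_omega_0 e l"
    then have \<beta>: "\<beta> \<in> positive_roots e l" "reversal \<beta> = \<beta>"
      by (auto simp: positive_roots_omega_0_def average_omega_eq_0)
    then have "\<beta> \<in> roots_C" by (simp add: positive_roots_def type_C_roots_eq)
    then obtain p s where ps: "p \<in> {1..l}" "s \<in> {1, -1::real}" "\<beta> = s *\<^sub>R (e p + e (l + 1 - p))"
      using reversal_fixed_root \<beta>(2) by blast
    have "s = 1"
      using ps positive_roots_rho[OF \<beta>(1)] rho_add[OF ps(1) reflected_index[OF ps(1)]]
      by (auto simp: of_nat_diff simp del: minus_add_distrib)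
    show "\<beta> \<in> {e p + e (l - p + 1) | p. p \<in> {1..(l + 1) div 2}}"
    proof (cases "p \<le> (l + 1) div 2")
      case True
      then show ?thesis using ps \<open>s = 1\<close> by (auto simp: Suc_diff_le intro!: exI[of _ p])
    next
      case False
      then have "l + 1 - p \<in> {1..(l + 1) div 2}" "l - (l + 1 - p) + 1 = p" using ps by auto
      then show ?thesis using ps \<open>s = 1\<close> by (auto simp: add.commute intro!: exI[of _ "l + 1 - p"])
    qed
  qed
  show "{e p + e (l - p + 1) | p. p \<in> {1..(l + 1) div 2}} \<subseteq> positive_roots_omega_0 e l"
  proof clarify
    fix p assume p: "p \<in> {1..(l + 1) div 2}"
    then have "p \<in> {1..l}" "l + 1 - p = l - p + 1" by auto
    then have "reversal (e p + e (l - p + 1)) = e p + e (l - p + 1)"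
      using reversal_symmetric_sum[of p] by simp
    then show "e p + e (l - p + 1) \<in> positive_roots_omega_0 e l"
      using symmetric_sum_positive[OF p] by (simp add: positive_roots_omega_0_def average_omega_eq_0)
  qed
qed

section \<open>The last fundamental coweight\<close>

text \<open>The defining equations say that the coordinates of the coweight are all equal, by the simple
  roots \<open>e i - e (i + 1)\<close>, and that the last one is \<open>1 / 2\<close>, by \<open>2 e l\<close>.\<close>

lemma fund_coweight_l: "fund_coweight e l l = (\<Sum>p = 1..l. (1 / 2) *\<^sub>R e p)"
proof -
  define v where "v = (\<Sum>p = 1..l. (1 / 2) *\<^sub>R e p)"
  have v: "e p \<bullet> v = 1 / 2" if "p \<in> {1..l}" for p
    unfolding v_def by (rule inner_sum_e[OF that])
  have "(THE v. \<forall>i\<in>{1..l}. simple_root e l i \<bullet> v = (if i = l then 1 else 0)) = v"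
  proof (rule the_equality)
    show "\<forall>i\<in>{1..l}. simple_root e l i \<bullet> v = (if i = l then 1 else 0)"
    proof
      fix i assume i: "i \<in> {1..l}"
      then show "simple_root e l i \<bullet> v = (if i = l then 1 else 0)"
        using v[of i] v[of "i + 1"] by (cases "i = l") (auto simp: simple_root_def inner_diff_left)
    qed
    fix u assume u: "\<forall>i\<in>{1..l}. simple_root e l i \<bullet> u = (if i = l then 1 else 0)"
    have eu: "p \<le> l \<Longrightarrow> 1 \<le> p \<Longrightarrow> e p \<bullet> u = 1 / 2" for p
    proof (induction p rule: inc_induct)
      case base
      then show ?case using bspec[OF u, of l] by (simp add: simple_root_def)
    next
      case (step p)
      then show ?case using bspec[OF u, of p] by (simp add: simple_root_def inner_diff_left)
    qed
    show "u = v"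
    proof (rule euclidean_eqI)
      fix b :: 'a assume "b \<in> Basis"
      then obtain p where p: "p \<in> {1..l}" "b = e p" unfolding Basis_eq by blast
      then show "u \<bullet> b = v \<bullet> b" using eu[of p] v[of p] by (simp add: inner_commute)
    qed
  qed
  then show ?thesis using l_pos by (simp add: fund_coweight_def v_def)
qed

lemma orbit_sigma_0: "orbit (sigma l) 0 = {0, l}"
proof
  show "orbit (sigma l) 0 \<subseteq> {0, l}"
  proof
    fix x assume "x \<in> orbit (sigma l) 0"
    then show "x \<in> {0, l}" by induction (auto simp: sigma_def)
  qed
  have "l \<in> orbit (sigma l) 0" using orbit.base[of "sigma l" 0] by (simp add: sigma_def)
  moreover from orbit.step[OF this] have "0 \<in> orbit (sigma l) 0" by (simp add: sigma_def)
  ultimately show "{0, l} \<subseteq> orbit (sigma l) 0" by simp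
qed

lemma inner_e_pi_zero:
  assumes "p \<in> {1..l}"
  shows "e p \<bullet> pi_zero e l = 1 / 2"
proof -
  have "pi_zero e l = (\<Sum>p = 1..l. (1 / 2) *\<^sub>R e p)"
    using l_pos fund_coweight_l by (simp add: pi_zero_def orbit_sigma_0) (simp add: fund_coweight_def)
  then show ?thesis using inner_sum_e[OF assms, of "\<lambda>_. 1 / 2"] by simp
qed

lemma P_zero_eq: "P_zero e l = {1, -1}"
proof
  have inner: "s *\<^sub>R (e p + e (l + 1 - p)) \<bullet> pi_zero e l = s" if "p \<in> {1..l}" for p s
    using inner_e_pi_zero[OF that] inner_e_pi_zero[OF reflected_index[OF that]]
    by (simp add: inner_add_left)
  show "P_zero e l \<subseteq> {1, -1}"
  proof
    fix x assume "x \<in> P_zero e l"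
    then obtain \<gamma> where "\<gamma> \<in> roots_C" "reversal \<gamma> = \<gamma>" "x = \<gamma> \<bullet> pi_zero e l"
      by (auto simp: P_zero_def type_C_roots_eq average_omega_eq_0)
    then show "x \<in> {1, -1}" using reversal_fixed_root[of \<gamma>] inner by metis
  qed
  show "{1, -1} \<subseteq> P_zero e l"
  proof
    fix s :: real assume s: "s \<in> {1, -1}"
    have "1 \<in> {1..l}" using l_pos by simp
    then have "s *\<^sub>R (e 1 + e (l + 1 - 1)) \<in> roots_C"
      "reversal (s *\<^sub>R (e 1 + e (l + 1 - 1))) = s *\<^sub>R (e 1 + e (l + 1 - 1))"
      "s = s *\<^sub>R (e 1 + e (l + 1 - 1)) \<bullet> pi_zero e l"
      using symmetric_sum_root[OF _ s] reversal_symmetric_sum[of 1] inner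
      by (simp_all only: linear_scale[OF linear_reversal])
    then show "s \<in> P_zero e l"
      unfolding P_zero_def type_C_roots_eq average_omega_eq_0 by blast
  qed
qed

end

theorem proposition5p8:
  fixes e :: "nat \<Rightarrow> real ^ 'n" and l :: nat
  assumes "l \<ge> 3"
    and "bij_betw e {1..l} Basis"
  shows "positive_roots_omega_0 e l = {e p + e (l - p + 1) | p. p \<in> {1..(l + 1) div 2}} \<and>
    positive_roots_omega_0 e l =
      {(\<Sum>k = i..l - i. simple_root e l k) + (\<Sum>k = l - i + 1..l - 1. 2 *\<^sub>R simple_root e l k)
          + simple_root e l l | i. i \<in> {1..(l + 1) div 2}} \<and>
    P_zero e l = {1, -1}"
proof -
  interpret ordered_basis e l by (rule ordered_basis.intro[OF assms(2)])
  have "{e p + e (l - p + 1) | p. p \<in> {1..(l + 1) div 2}} =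
      {(\<Sum>k = i..l - i. simple_root e l k) + (\<Sum>k = l - i + 1..l - 1. 2 *\<^sub>R simple_root e l k)
          + simple_root e l l | i. i \<in> {1..(l + 1) div 2}}"
    unfolding Setcompr_eq_image by (intro image_cong refl symmetric_sum_expansion[symmetric])
  then show ?thesis using positive_roots_omega_0_eq P_zero_eq by simp
qed

end
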